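(* Let $n,r$ be positive integers with $n\ge r$. Let $V=\mathbb{C}^n$, $\underline{V}=V\oplus\mathbb{C}\eta\cong\mathbb{C}^{n+1}$, $G=\mathrm{GL}(V)$, and let $\underline{G}\rtimes\mathbf{G}_m\subseteq\mathrm{GL}(\underline{V})$ be the associated parabolic subgroup. Then the space of $\underline{G}\rtimes\mathbf{G}_m$-invariants in the mixed tensor product $\underline{V}^{\otimes r}\otimes(\underline{V}^{*})^{\otimes r}$ is generated (i.e. spanned as a $\mathbb{C}$-vector space) by the elements $$C_\sigma=\sum_{\mathbf{i}\in\{1,\dots,n+1\}^r}\eta_{\sigma.\mathbf{i}}\otimes\eta_{\mathbf{i}}^*,\qquad \sigma\in\mathfrak{S}_r.$$
   Context: All vector spaces are over $\mathbb{C}$. $V$ is $n$-dimensional with basis $\eta_1,\dots,\eta_n$, and $\underline{V}=V\oplus\mathbb{C}\eta_{n+1}$ with $\eta_{n+1}:=\eta$; $\{\eta_1^*,\dots,\eta_{n+1}^*\}$ is the dual basis of $\underline{V}^*$. For $\mathbf{i}=(i_1,\dots,i_r)\in\{1,\dots,n+1\}^r$ put $\eta_{\mathbf{i}}=\eta_{i_1}\otimes\cdots\otimes\eta_{i_r}\in\underline{V}^{\otimes r}$ and $\eta_{\mathbf{i}}^*=\eta_{i_1}^*\otimes\cdots\otimes\eta_{i_r}^*\in(\underline{V}^* )^{\otimes r}$. For $\sigma\in\mathfrak{S}_r$, $\sigma.\mathbf{i}=(i_{\sigma^{-1}(1)},\dots,i_{\sigma^{-1}(r)})$. The enhanced group is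 $\underline{G}=G\ltimes V$ with $G=\mathrm{GL}(V)$, i.e. the set $G\times V$ with product $(g_1,v_1)(g_2,v_2)=(g_1g_2,\,g_1v_2+v_1)$; it acts faithfully on $\underline{V}$ by $(g,v)\cdot(u+a\eta)=g(u)+av+a\eta$ ($u\in V$, $a\in\mathbb{C}$), and so is regarded as a subgroup of $\mathrm{GL}(\underline{V})$. The group $\mathbf{G}_m=\mathbb{C}^\times$ is embedded in $\mathrm{GL}(\underline{V})$ with $c$ acting as the identity on $V$ and by $\eta\mapsto c\eta$. Then $\underline{G}\rtimes\mathbf{G}_m$ denotes the subgroup of $\mathrm{GL}(\underline{V})$ generated by $\underline{G}$ and $\mathbf{G}_m$; it is the parabolic subgroup of all elements of $\mathrm{GL}(\underline{V})$ that stabilize $V$. It acts diagonally on $\underline{V}^{\otimes r}\otimes(\underline{V}^* )^{\otimes r}$, via the natural action on $\underline{V}$ and the dual (contragredient) action on $\underline{V}^*$. *)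

theory Defs
  imports "HOL-Analysis.Analysis" "HOL-Algebra.Generated_Groups"
begin

text \<open>
  Conventions. The space \<open>V\<close> is \<open>complex ^ 'n\<close>, so \<open>n = CARD('n)\<close>, and \<open>V \<oplus> \<complex>\<eta>\<close> is
  \<open>complex ^ ('n option)\<close>: the index \<open>Some i\<close> belongs to the basis vector \<open>\<eta>\<^sub>i\<close> of \<open>V\<close> and
  \<open>None\<close> to \<open>\<eta>\<close>. Tensor positions form a finite type \<open>'r\<close>, so \<open>r = CARD('r)\<close> and a
  multi-index is a function \<open>'r \<Rightarrow> 'n option\<close>.
\<close>

type_synonym 'n enh_space = "complex ^ ('n option)"

type_synonym ('n, 'r) multi_index = "'r \<Rightarrow> 'n option"

definition eta :: "'n option \<Rightarrow> ('n::finite) enh_space" where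
  "eta i = axis i 1"

definition eta_dual :: "'n option \<Rightarrow> ('n::finite) enh_space \<Rightarrow> complex" where
  "eta_dual i = (\<lambda>w. w $ i)"

text \<open>The vector \<open>u + a \<eta>\<close>.\<close>

definition enh_vec :: "complex ^ 'n \<Rightarrow> complex \<Rightarrow> ('n::finite) enh_space" where
  "enh_vec u a = (\<chi> i. case i of Some k \<Rightarrow> u $ k | None \<Rightarrow> a)"

definition GL :: "(complex ^ 'm ^ 'm::finite) monoid" where
  "GL = \<lparr>carrier = {A. invertible A}, monoid.mult = (**), one = mat 1\<rparr>"

text \<open>
  The matrix of the pair \<open>(g, v)\<close>, i.e. of \<open>u + a \<eta> \<mapsto> g u + a v + a \<eta>\<close>; see
  \<open>enh_matrix_apply\<close> below.
\<close>

definition enh_matrix ::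
  "complex ^ 'n ^ 'n \<Rightarrow> complex ^ 'n \<Rightarrow> complex ^ ('n option) ^ ('n::finite option)" where
  "enh_matrix g v = (\<chi> i j. case i of
       Some k \<Rightarrow> (case j of Some l \<Rightarrow> g $ k $ l | None \<Rightarrow> v $ k)
     | None \<Rightarrow> (case j of Some l \<Rightarrow> 0 | None \<Rightarrow> 1))"

definition enhanced_group :: "(complex ^ ('n option) ^ ('n::finite option)) set" where
  "enhanced_group = {enh_matrix g v | g v. g \<in> carrier GL}"

text \<open>The matrix of \<open>u + a \<eta> \<mapsto> u + c a \<eta>\<close>.\<close>

definition scale_eta_matrix :: "complex \<Rightarrow> complex ^ ('n option) ^ ('n::finite option)" where
  "scale_eta_matrix c = (\<chi> i j. if i = j then (if i = None then c else 1) else 0)"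

definition Gm_group :: "(complex ^ ('n option) ^ ('n::finite option)) set" where
  "Gm_group = {scale_eta_matrix c | c. c \<noteq> 0}"

definition parabolic_group :: "(complex ^ ('n option) ^ ('n::finite option)) set" where
  "parabolic_group = generate GL (enhanced_group \<union> Gm_group)"

text \<open>
  A mixed tensor is stored by its coordinates with respect to the basis
  \<open>\<eta>\<^bsub>i\<^esub> \<otimes> \<eta>\<^bsub>j\<^esub>\<^sup>*\<close>, where \<open>i\<close>, \<open>j\<close> run over the multi-indices. The map \<open>pure_tensor\<close> is
  \<open>(u, \<phi>) \<mapsto> u\<^sub>1 \<otimes> \<dots> \<otimes> u\<^sub>r \<otimes> \<phi>\<^sub>1 \<otimes> \<dots> \<otimes> \<phi>\<^sub>r\<close>, for vectors \<open>u\<close> and linear functionals \<open>\<phi>\<close>.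
  It is multilinear and takes the pairs of basis families to the standard basis, which
  makes this space the tensor product.
\<close>

type_synonym ('n, 'r) mixed_tensor =
  "complex ^ (('n, 'r) multi_index \<times> ('n, 'r) multi_index)"

definition pure_tensor ::
  "('r \<Rightarrow> 'n enh_space) \<Rightarrow> ('r \<Rightarrow> 'n enh_space \<Rightarrow> complex) \<Rightarrow> ('n::finite, 'r::finite) mixed_tensor"
  where
  "pure_tensor u \<phi> =
     (\<chi> p. (\<Prod>k\<in>UNIV. eta_dual (fst p k) (u k)) * (\<Prod>k\<in>UNIV. \<phi> k (eta (snd p k))))"

definition contragredient ::
  "complex ^ ('n option) ^ ('n option) \<Rightarrow> (('n::finite) enh_space \<Rightarrow> complex) \<Rightarrow> 'n enh_space \<Rightarrow> complex"
  where
  "contragredient g \<phi> = (\<lambda>w. \<phi> (matrix_inv g *v w))"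

text \<open>
  The linear extension of the diagonal action on the basis tensors; \<open>tensor_action_pure\<close>
  below gives the action on an arbitrary pure tensor.
\<close>

definition tensor_action ::
  "complex ^ ('n option) ^ ('n option) \<Rightarrow> ('n, 'r) mixed_tensor \<Rightarrow> ('n::finite, 'r::finite) mixed_tensor"
  where
  "tensor_action g T =
     (\<Sum>(i, j)\<in>UNIV. T $ (i, j) *s
        pure_tensor (\<lambda>k. g *v eta (i k)) (\<lambda>k. contragredient g (eta_dual (j k))))"

definition tensor_invariants ::
  "(complex ^ ('n option) ^ ('n option)) set \<Rightarrow> ('n::finite, 'r::finite) mixed_tensor set" where
  "tensor_invariants H = {T. \<forall>h\<in>H. tensor_action h T = T}"

definition perm_index :: "('r \<Rightarrow> 'r) \<Rightarrow> ('n, 'r) multi_index \<Rightarrow> ('n, 'r) multi_index" where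
  "perm_index \<sigma> i = (\<lambda>k. i (inv_into UNIV \<sigma> k))"

definition C_tensor :: "('r \<Rightarrow> 'r) \<Rightarrow> ('n::finite, 'r::finite) mixed_tensor" where
  "C_tensor \<sigma> =
     (\<Sum>i\<in>UNIV. pure_tensor (\<lambda>k. eta (perm_index \<sigma> i k)) (\<lambda>k. eta_dual (i k)))"

lemma sum_option: "(\<Sum>j\<in>(UNIV::'n::finite option set). f j) = f None + (\<Sum>l\<in>UNIV. f (Some l))"
  by (simp add: UNIV_option_conv sum.reindex)

lemma group_GL: "group (GL :: (complex ^ 'm ^ 'm::finite) monoid)"
proof (rule groupI)
  fix x :: "complex ^ 'm ^ 'm" assume "x \<in> carrier GL"
  then show "\<exists>y\<in>carrier GL. y \<otimes>\<^bsub>GL\<^esub> x = \<one>\<^bsub>GL\<^esub>"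
    by (auto simp: GL_def invertible_def)
qed (auto simp: GL_def invertible_mult matrix_mul_assoc intro!: exI [of _ "mat 1"]
    simp: invertible_def [of "mat 1"])

lemma enh_matrix_apply: "enh_matrix g v *v enh_vec u a = enh_vec (g *v u + a *s v) a"
  by (simp add: vec_eq_iff enh_matrix_def enh_vec_def matrix_vector_mult_def sum_option
      algebra_simps split: option.splits)

lemma enh_matrix_mult: "enh_matrix g v ** enh_matrix h w = enh_matrix (g ** h) (g *v w + v)"
  by (auto simp: vec_eq_iff enh_matrix_def matrix_matrix_mult_def matrix_vector_mult_def sum_option
      algebra_simps split: option.splits)

lemma scale_eta_matrix_apply: "scale_eta_matrix c *v enh_vec u a = enh_vec u (c * a)"
  by (auto simp: vec_eq_iff scale_eta_matrix_def enh_vec_def matrix_vector_mult_def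
      if_distrib [where f = "\<lambda>x. x * y" for y] cong: if_cong split: option.splits)

lemma enh_matrix_id: "enh_matrix (mat 1) 0 = mat 1"
  by (auto simp: vec_eq_iff enh_matrix_def mat_def split: option.splits)

lemma scale_eta_matrix_mult: "scale_eta_matrix c ** scale_eta_matrix d = scale_eta_matrix (c * d)"
  by (auto simp: vec_eq_iff scale_eta_matrix_def matrix_matrix_mult_def
      if_distrib [where f = "\<lambda>x. x * y" for y] cong: if_cong)

lemma scale_eta_matrix_id: "scale_eta_matrix 1 = mat 1"
  by (auto simp: vec_eq_iff scale_eta_matrix_def mat_def)

lemma inv_GL:
  assumes "A ** B = mat 1"
  shows "A \<in> carrier GL" "B \<in> carrier GL" "inv\<^bsub>GL\<^esub> A = B"
proof -
  have BA: "B ** A = mat 1" using assms matrix_left_right_inverse by blast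
  show A: "A \<in> carrier GL" and B: "B \<in> carrier GL"
    using assms BA by (auto simp: GL_def invertible_def)
  show "inv\<^bsub>GL\<^esub> A = B"
    using group.inv_equality [OF group_GL _ A B] BA by (simp add: GL_def)
qed

lemma invertible_matrix_inv:
  assumes "invertible (g :: complex ^ 'm ^ 'm)"
  shows "g ** matrix_inv g = mat 1" "matrix_inv g ** g = mat 1"
  using someI_ex [OF assms [unfolded invertible_def]] by (simp_all add: matrix_inv_def)

lemma enh_matrix_inverse:
  assumes "invertible g"
  shows "enh_matrix g v ** enh_matrix (matrix_inv g) (- (matrix_inv g *v v)) = mat 1"
  using assms
  by (simp add: enh_matrix_mult enh_matrix_id invertible_matrix_inv matrix_vector_mul_assoc
      vec.neg)

lemma scale_eta_matrix_inverse:
  "c \<noteq> 0 \<Longrightarrow> scale_eta_matrix c ** scale_eta_matrix (inverse c) = mat 1"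
  by (simp add: scale_eta_matrix_mult scale_eta_matrix_id)

lemma generators_subset_GL: "enhanced_group \<union> Gm_group \<subseteq> carrier GL"
  using inv_GL(1) [OF enh_matrix_inverse] inv_GL(1) [OF scale_eta_matrix_inverse]
  by (auto simp: enhanced_group_def Gm_group_def GL_def)

lemma generators_inv_closed:
  assumes "A \<in> enhanced_group \<union> Gm_group"
  shows "inv\<^bsub>GL\<^esub> A \<in> enhanced_group \<union> Gm_group"
  using assms
proof
  assume "A \<in> enhanced_group"
  then obtain g v where A: "A = enh_matrix g v" "invertible g"
    by (auto simp: enhanced_group_def GL_def)
  have "invertible (matrix_inv g)"
    using A(2) invertible_def invertible_matrix_inv by blast
  then show ?thesis
    using inv_GL(3) [OF enh_matrix_inverse [OF A(2)]] A(1)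
    by (auto simp: enhanced_group_def GL_def)
next
  assume "A \<in> Gm_group"
  then obtain c where A: "A = scale_eta_matrix c" "c \<noteq> 0"
    by (auto simp: Gm_group_def)
  have "inverse c \<noteq> 0" using A(2) by simp
  then show ?thesis
    using inv_GL(3) [OF scale_eta_matrix_inverse [OF A(2)]] A(1)
    by (auto simp: Gm_group_def simp del: inverse_nonzero_iff_nonzero)
qed

lemma stabilizes_iff:
  "(\<forall>u. \<exists>u'. A *v enh_vec u 0 = enh_vec u' 0) \<longleftrightarrow> (\<forall>l. A $ None $ Some l = 0)"
proof safe
  fix l
  assume "\<forall>u. \<exists>u'. A *v enh_vec u 0 = enh_vec u' 0"
  then obtain u' where "A *v enh_vec (axis l 1) 0 = enh_vec u' 0" by blast
  then have "(A *v enh_vec (axis l 1) 0) $ None = 0" by (simp add: enh_vec_def)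
  then show "A $ None $ Some l = 0"
    by (simp add: matrix_vector_mult_def enh_vec_def sum_option axis_def if_distrib cong: if_cong)
next
  fix u
  assume "\<forall>l. A $ None $ Some l = 0"
  then have "A *v enh_vec u 0 = enh_vec (\<chi> k. (A *v enh_vec u 0) $ Some k) 0"
    by (auto simp: vec_eq_iff matrix_vector_mult_def enh_vec_def sum_option split: option.splits)
  then show "\<exists>u'. A *v enh_vec u 0 = enh_vec u' 0" by blast
qed

lemma parabolic_group_eq_stabilizer:
  "(parabolic_group :: (complex ^ ('n option) ^ ('n::finite option)) set) =
     {A \<in> carrier GL. \<forall>u. \<exists>u'. A *v enh_vec u 0 = enh_vec u' 0}"
    (is "_ = ?S")
proof
  have gen: "A \<in> ?S" if "A \<in> enhanced_group \<union> Gm_group" for A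
    using that generators_subset_GL
    by (auto simp: enhanced_group_def Gm_group_def enh_matrix_apply scale_eta_matrix_apply)
  show "parabolic_group \<subseteq> ?S"
  proof
    fix A :: "complex ^ ('n option) ^ ('n option)"
    assume "A \<in> parabolic_group"
    then have "A \<in> generate GL (enhanced_group \<union> Gm_group)"
      by (simp add: parabolic_group_def)
    then show "A \<in> ?S"
    proof (induction rule: generate.induct)
      case one
      then show ?case by (auto simp: GL_def invertible_def)
    next
      case (incl h)
      then show ?case using gen by blast
    next
      case (inv h)
      then show ?case using gen generators_inv_closed by blast
    next
      case (eng h1 h2)
      then show ?case
        by (auto simp: GL_def invertible_mult simp flip: matrix_vector_mul_assoc) metis
    qed
  qed
  show "?S \<subseteq> parabolic_group"
  proof
    fix A :: "complex ^ ('n option) ^ ('n option)"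
    assume "A \<in> ?S"
    then have inv: "invertible A" and A0: "\<And>l. A $ None $ Some l = 0"
      unfolding stabilizes_iff by (auto simp: GL_def)
    then obtain B where "A ** B = mat 1" by (auto simp: invertible_def)
    then have B: "(A ** B) $ i $ j = (if i = j then 1 else 0)" for i j
      by (simp add: mat_def)
    define c where "c = A $ None $ None"
    define g where "g = (\<chi> k l. A $ Some k $ Some l)"
    define v where "v = (\<chi> k. A $ Some k $ None)"
    have c: "c \<noteq> 0"
      using B [of None None] by (auto simp: matrix_matrix_mult_def sum_option A0 c_def)
    have B0: "B $ None $ Some l = 0" for l
      using B [of None "Some l"] c by (simp add: matrix_matrix_mult_def sum_option A0 c_def)
    have "g ** (\<chi> k l. B $ Some k $ Some l) = mat 1"
      using B [of "Some _" "Some _"]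
      by (simp add: matrix_matrix_mult_def sum_option B0 g_def mat_def vec_eq_iff)
    then have g: "g \<in> carrier GL" by (rule inv_GL)
    have "A = enh_matrix g (inverse c *s v) ** scale_eta_matrix c"
      using c by (auto simp: vec_eq_iff matrix_matrix_mult_def sum_option enh_matrix_def
          scale_eta_matrix_def A0 c_def g_def v_def if_distrib cong: if_cong split: option.splits)
    moreover have "enh_matrix g (inverse c *s v) \<in> parabolic_group"
      unfolding parabolic_group_def
      by (rule generate.incl) (use g in \<open>auto simp: enhanced_group_def\<close>)
    moreover have "scale_eta_matrix c \<in> parabolic_group"
      unfolding parabolic_group_def
      by (rule generate.incl) (use c in \<open>auto simp: Gm_group_def\<close>)
    ultimately show "A \<in> parabolic_group"
      unfolding parabolic_group_def using generate.eng by (fastforce simp: GL_def)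
  qed
qed

lemma pure_tensor_basis:
  "pure_tensor (\<lambda>k. eta (i k)) (\<lambda>k. eta_dual (j k)) = axis (i, j) 1"
proof -
  have "(\<Prod>k\<in>UNIV. if a k = b k then 1 else 0) = (if a = b then 1 else (0::complex))"
    for a b :: "'b \<Rightarrow> 'a option"
  proof (cases "a = b")
    case False
    then obtain k where "a k \<noteq> b k" by blast
    then show ?thesis using False by (auto intro!: prod_zero)
  qed simp
  then show ?thesis
    by (auto simp: vec_eq_iff pure_tensor_def eta_def eta_dual_def axis_def)
qed

lemma pure_tensor_add_left:
  "pure_tensor (u(k := x + y)) \<phi> = pure_tensor (u(k := x)) \<phi> + pure_tensor (u(k := y)) \<phi>"
  by (simp add: vec_eq_iff pure_tensor_def prod.remove [of UNIV k] eta_dual_def algebra_simps)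

lemma pure_tensor_scale_left:
  "pure_tensor (u(k := c *s x)) \<phi> = c *s pure_tensor (u(k := x)) \<phi>"
  by (simp add: vec_eq_iff pure_tensor_def prod.remove [of UNIV k] eta_dual_def algebra_simps)

lemma pure_tensor_add_right:
  "pure_tensor u (\<phi>(k := \<lambda>w. f w + g w)) = pure_tensor u (\<phi>(k := f)) + pure_tensor u (\<phi>(k := g))"
  by (simp add: vec_eq_iff pure_tensor_def prod.remove [of UNIV k] algebra_simps)

lemma pure_tensor_scale_right:
  "pure_tensor u (\<phi>(k := \<lambda>w. c * f w)) = c *s pure_tensor u (\<phi>(k := f))"
  by (simp add: vec_eq_iff pure_tensor_def prod.remove [of UNIV k] algebra_simps)

lemma linear_functional_expansion:
  assumes "Vector_Spaces.linear (*s) (*) \<phi>"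
  shows "\<phi> w = (\<Sum>l\<in>UNIV. eta_dual l w * \<phi> (eta l))"
proof -
  interpret Vector_Spaces.linear "(*s)" "(*)" \<phi> by fact
  have "w = (\<Sum>l\<in>UNIV. eta_dual l w *s eta l)"
    using basis_expansion [of w] by (simp add: eta_def eta_dual_def)
  then have "\<phi> w = \<phi> (\<Sum>l\<in>UNIV. eta_dual l w *s eta l)" by simp
  then show ?thesis by (simp add: sum scale)
qed

lemma tensor_action_pure:
  fixes u :: "'r::finite \<Rightarrow> ('n::finite) enh_space"
  assumes "\<And>k. Vector_Spaces.linear (*s) (*) (\<phi> k)"
  shows "tensor_action g (pure_tensor u \<phi>) =
         pure_tensor (\<lambda>k. g *v u k) (\<lambda>k. contragredient g (\<phi> k))"
proof -
  have prod_sum: "(\<Sum>i\<in>UNIV. \<Prod>k\<in>UNIV. f k (i k)) = (\<Prod>k\<in>UNIV. \<Sum>l\<in>UNIV. f k l)"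
    for f :: "'r \<Rightarrow> 'n option \<Rightarrow> complex"
    using prod_sum_PiE [of UNIV "\<lambda>_. UNIV" f] by simp
  have left: "(\<Sum>l\<in>UNIV. eta_dual l w * eta_dual a (g *v eta l)) = eta_dual a (g *v w)" for a w
    by (simp add: eta_def eta_dual_def matrix_vector_mult_def axis_def if_distrib
        mult.commute cong: if_cong)
  have right: "(\<Sum>l\<in>UNIV. \<phi> k (eta l) * contragredient g (eta_dual l) (eta b))
      = contragredient g (\<phi> k) (eta b)" for k b
    by (simp add: contragredient_def linear_functional_expansion [OF assms, of k "_ *v _"]
        mult.commute)
  have "tensor_action g (pure_tensor u \<phi>) $ (a, b) =
        pure_tensor (\<lambda>k. g *v u k) (\<lambda>k. contragredient g (\<phi> k)) $ (a, b)" for a b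
  proof -
    have "tensor_action g (pure_tensor u \<phi>) $ (a, b) =
      (\<Sum>(i, j)\<in>UNIV. (\<Prod>k\<in>UNIV. eta_dual (i k) (u k) * eta_dual (a k) (g *v eta (i k))) *
        (\<Prod>k\<in>UNIV. \<phi> k (eta (j k)) * contragredient g (eta_dual (j k)) (eta (b k))))"
      by (simp add: tensor_action_def pure_tensor_def case_prod_unfold prod.distrib mult_ac)
    also have "\<dots> = (\<Sum>i\<in>UNIV. \<Prod>k\<in>UNIV. eta_dual (i k) (u k) * eta_dual (a k) (g *v eta (i k))) *
        (\<Sum>j\<in>UNIV. \<Prod>k\<in>UNIV. \<phi> k (eta (j k)) * contragredient g (eta_dual (j k)) (eta (b k)))"
      unfolding UNIV_Times_UNIV [symmetric] sum_product
      by (rule sum.cartesian_product [symmetric])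
    also have "\<dots> = pure_tensor (\<lambda>k. g *v u k) (\<lambda>k. contragredient g (\<phi> k)) $ (a, b)"
      using prod_sum [of "\<lambda>k l. eta_dual l (u k) * eta_dual (a k) (g *v eta l)"]
        prod_sum [of "\<lambda>k l. \<phi> k (eta l) * contragredient g (eta_dual l) (eta (b k))"]
      by (simp add: left right pure_tensor_def)
    finally show ?thesis .
  qed
  then show ?thesis by (simp add: vec_eq_iff)
qed

end

theory Submission
  imports Defs
begin

text \<open>
  Read a mixed tensor as an operator on the \<open>r\<close>-th tensor power; it is invariant under \<open>g\<close> iff
  it commutes with the tensor power of \<open>g\<close>. As \<open>r \<le> n\<close>, there is an injective multi-index \<open>j\<close>
  with values in the basis of \<open>V\<close>. By torus invariance an invariant \<open>T\<close> maps \<open>\<eta>\<^sub>j\<close> to a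
  combination of the permuted tensors \<open>\<eta>\<^bsub>\<sigma>.j\<^esub>\<close>, so subtracting the same combination of the
  \<open>C\<^sub>\<sigma>\<close> gives an invariant killing \<open>\<eta>\<^sub>j\<close>. Permutation matrices and the transvections
  \<open>\<eta>\<^sub>a \<mapsto> \<eta>\<^sub>a + \<eta>\<^sub>b\<close> of the parabolic group then force this invariant to kill all basis
  tensors, including those that contain \<open>\<eta>\<close>.
\<close>

section \<open>Invariance as commutation with tensor powers\<close>

definition tensor_power_matrix ::
  "complex ^ 'm ^ 'm \<Rightarrow> complex ^ ('r \<Rightarrow> 'm) ^ ('r::finite \<Rightarrow> 'm::finite)" where
  "tensor_power_matrix g = (\<chi> i j. \<Prod>k\<in>UNIV. g $ i k $ j k)"

text \<open>The basis tensor indexed by \<open>(i, j)\<close> becomes a matrix unit, so column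
  \<open>j\<close> holds the image of the basis tensor at \<open>j\<close> under the
  operator.\<close>

definition coeff_matrix ::
  "('n::finite, 'r::finite) mixed_tensor \<Rightarrow>
     complex ^ (('n, 'r) multi_index) ^ (('n, 'r) multi_index)" where
  "coeff_matrix T = (\<chi> i j. T $ (i, j))"

lemma tensor_power_matrix_mult:
  "tensor_power_matrix (g ** h) = tensor_power_matrix g ** tensor_power_matrix h"
proof -
  have "(\<Prod>k\<in>UNIV. \<Sum>l\<in>UNIV. g $ i k $ l * h $ l $ j k) =
      (\<Sum>l\<in>UNIV. \<Prod>k\<in>UNIV. g $ i k $ l k * h $ l k $ j k)" for i j :: "'a \<Rightarrow> 'b"
    using prod_sum_PiE [of UNIV "\<lambda>_. UNIV" "\<lambda>k l. g $ i k $ l * h $ l $ j k"] by simp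
  then show ?thesis
    by (simp add: tensor_power_matrix_def matrix_matrix_mult_def vec_eq_iff prod.distrib)
qed

lemma prod_indicator_eq:
  "(\<Prod>k\<in>UNIV. if P k then 1 else 0) = (if \<forall>k::'r::finite. P k then 1 else (0::complex))"
  by (auto intro!: prod_zero)

lemma tensor_power_matrix_one: "tensor_power_matrix (mat 1) = mat 1"
  by (simp add: tensor_power_matrix_def mat_def vec_eq_iff prod_indicator_eq fun_eq_iff)

text \<open>The vector factors give the left multiplier. The dual factors give the right one, since
  \<open>contragredient g (eta_dual j)\<close> has row \<open>j\<close> of
  \<open>matrix_inv g\<close> as its coordinates.\<close>

lemma coeff_matrix_tensor_action:
  fixes T :: "('n::finite, 'r::finite) mixed_tensor"
  shows "coeff_matrix (tensor_action g T) =
     tensor_power_matrix g ** coeff_matrix T ** tensor_power_matrix (matrix_inv g)"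
proof -
  have col: "(A *v axis l 1) $ x = A $ x $ l" for A :: "complex ^ 'n option ^ 'n option" and x l
    by (simp add: matrix_vector_mult_def axis_def if_distrib cong: if_cong)
  have "tensor_action g T $ (a, b) =
      (\<Sum>j\<in>UNIV. (\<Sum>i\<in>UNIV. (\<Prod>k\<in>UNIV. g $ a k $ i k) * T $ (i, j)) *
        (\<Prod>k\<in>UNIV. matrix_inv g $ j k $ b k))" for a b
  proof -
    have "tensor_action g T $ (a, b) = (\<Sum>(i, j)\<in>UNIV. (\<Prod>k\<in>UNIV. g $ a k $ i k) * T $ (i, j) *
        (\<Prod>k\<in>UNIV. matrix_inv g $ j k $ b k))"
      by (simp add: tensor_action_def pure_tensor_def contragredient_def eta_def eta_dual_def
          col case_prod_unfold mult_ac)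
    also have "\<dots> = (\<Sum>i\<in>UNIV. \<Sum>j\<in>UNIV. (\<Prod>k\<in>UNIV. g $ a k $ i k) * T $ (i, j) *
        (\<Prod>k\<in>UNIV. matrix_inv g $ j k $ b k))"
      unfolding UNIV_Times_UNIV [symmetric] by (rule sum.cartesian_product [symmetric])
    also have "\<dots> = (\<Sum>j\<in>UNIV. \<Sum>i\<in>UNIV. (\<Prod>k\<in>UNIV. g $ a k $ i k) * T $ (i, j) *
        (\<Prod>k\<in>UNIV. matrix_inv g $ j k $ b k))"
      by (rule sum.swap)
    finally show ?thesis by (simp add: sum_distrib_right)
  qed
  then show ?thesis
    by (simp add: vec_eq_iff coeff_matrix_def tensor_power_matrix_def matrix_matrix_mult_def)
qed

lemma coeff_matrix_inject: "coeff_matrix S = coeff_matrix T \<longleftrightarrow> S = T"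
  by (auto simp: coeff_matrix_def vec_eq_iff)

lemma tensor_action_fixed_iff:
  assumes "invertible g"
  shows "tensor_action g T = T \<longleftrightarrow>
    tensor_power_matrix g ** coeff_matrix T = coeff_matrix T ** tensor_power_matrix g"
proof -
  let ?M = "tensor_power_matrix g :: complex ^ ('b \<Rightarrow> 'a option) ^ ('b \<Rightarrow> 'a option)"
  let ?N = "tensor_power_matrix (matrix_inv g) :: complex ^ ('b \<Rightarrow> 'a option) ^ ('b \<Rightarrow> 'a option)"
  have MN: "?M ** ?N = mat 1" "?N ** ?M = mat 1"
    by (simp_all add: invertible_matrix_inv [OF assms] tensor_power_matrix_one
        flip: tensor_power_matrix_mult)
  have "tensor_action g T = T \<longleftrightarrow> ?M ** coeff_matrix T ** ?N = coeff_matrix T"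
    by (simp add: coeff_matrix_tensor_action flip: coeff_matrix_inject)
  also have "\<dots> \<longleftrightarrow> ?M ** coeff_matrix T = coeff_matrix T ** ?M"
  proof
    assume "?M ** coeff_matrix T ** ?N = coeff_matrix T"
    then have "coeff_matrix T ** ?M = ?M ** coeff_matrix T ** (?N ** ?M)"
      by (simp add: matrix_mul_assoc)
    then show "?M ** coeff_matrix T = coeff_matrix T ** ?M" by (simp add: MN)
  next
    assume "?M ** coeff_matrix T = coeff_matrix T ** ?M"
    then show "?M ** coeff_matrix T ** ?N = coeff_matrix T"
      by (simp add: MN flip: matrix_mul_assoc)
  qed
  finally show ?thesis .
qed

lemma parabolic_group_iff:
  "g \<in> parabolic_group \<longleftrightarrow> invertible g \<and> (\<forall>l. g $ None $ Some l = 0)"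
  by (auto simp: parabolic_group_eq_stabilizer stabilizes_iff GL_def)

lemma tensor_invariants_parabolic_iff:
  "T \<in> tensor_invariants parabolic_group \<longleftrightarrow>
     (\<forall>g. invertible g \<longrightarrow> (\<forall>l. g $ None $ Some l = 0) \<longrightarrow>
       tensor_power_matrix g ** coeff_matrix T = coeff_matrix T ** tensor_power_matrix g)"
  by (auto simp: tensor_invariants_def parabolic_group_iff tensor_action_fixed_iff)

lemma invariant_commute:
  assumes "T \<in> tensor_invariants parabolic_group" "invertible g" "\<And>l. g $ None $ Some l = 0"
  shows "(\<Sum>l\<in>UNIV. (\<Prod>k\<in>UNIV. g $ i k $ l k) * T $ (l, j)) =
         (\<Sum>l\<in>UNIV. T $ (i, l) * (\<Prod>k\<in>UNIV. g $ l k $ j k))"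
proof -
  have "(tensor_power_matrix g ** coeff_matrix T) $ i $ j =
      (coeff_matrix T ** tensor_power_matrix g) $ i $ j"
    using assms by (simp add: tensor_invariants_parabolic_iff)
  then show ?thesis
    by (simp add: tensor_power_matrix_def coeff_matrix_def matrix_matrix_mult_def)
qed

section \<open>The invariants as a subspace\<close>

lemma coeff_matrix_add: "coeff_matrix (S + T) = coeff_matrix S + coeff_matrix T"
  by (simp add: coeff_matrix_def vec_eq_iff)

text \<open>Writing a scalar as the central matrix \<open>mat c\<close> reduces closure under
  scaling to associativity.\<close>

lemma coeff_matrix_scale: "coeff_matrix (c *s T) = mat c ** coeff_matrix T"
  by (simp add: coeff_matrix_def vec_eq_iff matrix_matrix_mult_def mat_def
      mult_delta_left mult_delta_right)

lemma mat_commute: "mat c ** A = A ** mat (c :: complex)"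
  by (simp add: vec_eq_iff matrix_matrix_mult_def mat_def mult.commute
      mult_delta_left mult_delta_right)

lemma matrix_add_mult: "(A + B) ** C = A ** C + B ** (C :: complex ^ 'm ^ 'm)"
  by (simp add: vec_eq_iff matrix_matrix_mult_def sum.distrib algebra_simps)

lemma subspace_tensor_invariants:
  "vec.subspace (tensor_invariants parabolic_group :: ('n::finite, 'r::finite) mixed_tensor set)"
proof (rule vec.subspaceI)
  show "0 \<in> tensor_invariants parabolic_group"
    by (simp add: tensor_invariants_parabolic_iff coeff_matrix_def matrix_matrix_mult_def vec_eq_iff)
next
  fix S T :: "('n, 'r) mixed_tensor"
  assume "S \<in> tensor_invariants parabolic_group" "T \<in> tensor_invariants parabolic_group"
  then show "S + T \<in> tensor_invariants parabolic_group"
    by (simp add: tensor_invariants_parabolic_iff coeff_matrix_add matrix_add_ldistrib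
        matrix_add_mult)
next
  fix c and T :: "('n, 'r) mixed_tensor"
  assume "T \<in> tensor_invariants parabolic_group"
  then show "c *s T \<in> tensor_invariants parabolic_group"
    by (simp add: tensor_invariants_parabolic_iff coeff_matrix_scale matrix_mul_assoc
        flip: mat_commute) (simp flip: matrix_mul_assoc)
qed

section \<open>Invariance of the permutation tensors\<close>

lemma C_tensor_nth: "C_tensor \<sigma> $ (i, j) = (if i = perm_index \<sigma> j then 1 else 0)"
proof -
  have "C_tensor \<sigma> $ (i, j) = (\<Sum>l\<in>UNIV. if l = j then if i = perm_index \<sigma> j then 1 else 0 else 0)"
    unfolding C_tensor_def sum_component pure_tensor_basis
    by (rule sum.cong) (auto simp: axis_def)
  then show ?thesis by simp
qed

text \<open>As an operator, \<open>C_tensor \<sigma>\<close> permutes tensor positions, so it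
  commutes with the tensor power of every matrix: each sum collapses to one product, and the two
  products differ by reindexing along \<open>\<sigma>\<close>.\<close>

lemma C_tensor_invariant:
  assumes "bij (\<sigma> :: 'r::finite \<Rightarrow> 'r)"
  shows "(C_tensor \<sigma> :: ('n::finite, 'r) mixed_tensor) \<in> tensor_invariants parabolic_group"
proof -
  have inv: "i = perm_index \<sigma> j \<longleftrightarrow> i \<circ> \<sigma> = j" for i j :: "'r \<Rightarrow> 'n option"
    unfolding perm_index_def fun_eq_iff comp_apply
    by (metis assms bij_is_inj bij_is_surj inv_f_f surj_f_inv_f)
  have reindex: "(\<Prod>k\<in>UNIV. g $ i k $ perm_index \<sigma> j k) = (\<Prod>k\<in>UNIV. g $ (i \<circ> \<sigma>) k $ j k)"
    for g :: "complex ^ 'n option ^ 'n option" and i j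
    using prod.reindex_bij_betw [OF assms, of "\<lambda>k. g $ i k $ perm_index \<sigma> j k"] assms
    by (simp add: perm_index_def bij_is_inj)
  have "tensor_power_matrix g ** coeff_matrix (C_tensor \<sigma>) =
      coeff_matrix (C_tensor \<sigma>) ** tensor_power_matrix g" for g :: "complex ^ 'n option ^ 'n option"
  proof -
    have "(\<Sum>l\<in>UNIV. (\<Prod>k\<in>UNIV. g $ i k $ l k) * C_tensor \<sigma> $ (l, j)) =
        (\<Sum>l\<in>UNIV. C_tensor \<sigma> $ (i, l) * (\<Prod>k\<in>UNIV. g $ l k $ j k))" for i j
    proof -
      have "(\<Sum>l\<in>UNIV. (\<Prod>k\<in>UNIV. g $ i k $ l k) * C_tensor \<sigma> $ (l, j)) =
          (\<Prod>k\<in>UNIV. g $ i k $ perm_index \<sigma> j k)"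
        by (simp add: C_tensor_nth mult_delta_right)
      moreover have "(\<Sum>l\<in>UNIV. C_tensor \<sigma> $ (i, l) * (\<Prod>k\<in>UNIV. g $ l k $ j k)) =
          (\<Prod>k\<in>UNIV. g $ (i \<circ> \<sigma>) k $ j k)"
        by (simp add: C_tensor_nth inv mult_delta_left mult_delta_right)
      ultimately show ?thesis by (simp add: reindex)
    qed
    then show ?thesis
      by (simp add: vec_eq_iff tensor_power_matrix_def coeff_matrix_def matrix_matrix_mult_def)
  qed
  then show ?thesis by (simp add: tensor_invariants_parabolic_iff)
qed

section \<open>Coefficient identities from special group elements\<close>

text \<open>Weight argument: the diagonal matrix with 2 at \<open>a\<close> and 1 elsewhere scales
  the basis tensor at \<open>i\<close> by 2 to the multiplicity of \<open>a\<close>, and the powers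
  of 2 are distinct.\<close>

lemma invariant_multiplicities:
  fixes T :: "('n::finite, 'r::finite) mixed_tensor"
  assumes "T \<in> tensor_invariants parabolic_group" "T $ (i, j) \<noteq> 0"
  shows "card {k. i k = a} = card {k. j k = a}"
proof -
  define d :: "complex \<Rightarrow> 'n option \<Rightarrow> complex" where "d z x = (if x = a then z else 1)" for z x
  define g :: "complex \<Rightarrow> complex ^ 'n option ^ 'n option"
    where "g z = (\<chi> x y. if x = y then d z x else 0)" for z
  have g: "g z ** g w = g (z * w)" for z w
    by (simp add: g_def d_def vec_eq_iff matrix_matrix_mult_def mult_delta_left mult_delta_right)
  have "g 1 = mat 1" by (simp add: g_def d_def mat_def vec_eq_iff)
  then have "invertible (g 2)"
    using g [of 2 "1/2"] g [of "1/2" 2] by (auto simp: invertible_def)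
  then have comm: "(\<Sum>l\<in>UNIV. (\<Prod>k\<in>UNIV. g 2 $ i k $ l k) * T $ (l, j)) =
         (\<Sum>l\<in>UNIV. T $ (i, l) * (\<Prod>k\<in>UNIV. g 2 $ l k $ j k))"
    by (intro invariant_commute assms) (auto simp: g_def)
  have diag: "(\<Prod>k\<in>UNIV. g 2 $ x k $ y k) = (if x = y then 2 ^ card {k. x k = a} else 0)"
    for x y :: "'r \<Rightarrow> 'n option"
  proof (cases "x = y")
    case True
    have "(\<Prod>k\<in>UNIV. d 2 (x k)) = (\<Prod>k\<in>{k. x k = a}. 2)"
      unfolding d_def by (simp add: prod.If_cases)
    then show ?thesis using True by (simp add: g_def)
  next
    case False
    then obtain k where "x k \<noteq> y k" by blast
    then show ?thesis using False by (auto simp: g_def intro!: prod_zero)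
  qed
  have "2 ^ card {k. i k = a} * T $ (i, j) = T $ (i, j) * 2 ^ card {k. j k = a}"
    using comm unfolding diag
    by (simp add: mult_delta_left mult_delta_right)
  then have "(2::complex) ^ card {k. i k = a} = 2 ^ card {k. j k = a}"
    using assms(2) by simp
  then have "of_nat (2 ^ card {k. i k = a}) = (of_nat (2 ^ card {k. j k = a}) :: complex)"
    by simp
  then show ?thesis unfolding of_nat_eq_iff by simp
qed

text \<open>The permutation matrix of \<open>\<pi>\<close> stabilizes \<open>V\<close> because
  \<open>\<pi>\<close> fixes \<open>None\<close>; in row \<open>\<pi> \<circ> i\<close> commutation
  leaves one term on each side.\<close>

lemma invariant_relabel:
  fixes T :: "('n::finite, 'r::finite) mixed_tensor"
  assumes "T \<in> tensor_invariants parabolic_group" "bij \<pi>" "\<pi> None = None"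
  shows "T $ (\<pi> \<circ> i, \<pi> \<circ> j) = T $ (i, j)"
proof -
  define g :: "complex ^ 'n option ^ 'n option" where "g = (\<chi> x y. if x = \<pi> y then 1 else 0)"
  have inj: "\<pi> x = \<pi> y \<longleftrightarrow> x = y" for x y
    using assms(2) by (simp add: bij_is_inj inj_eq)
  define h :: "complex ^ 'n option ^ 'n option" where "h = (\<chi> x y. if \<pi> x = y then 1 else 0)"
  have "h ** g = mat 1"
    by (simp add: g_def h_def vec_eq_iff matrix_matrix_mult_def mat_def inj
        mult_delta_left mult_delta_right)
  then have "invertible g" using matrix_left_right_inverse by (auto simp: invertible_def)
  moreover have "g $ None $ Some l = 0" for l
    using inj [of None "Some l"] assms(3) by (simp add: g_def)
  ultimately have comm: "(\<Sum>l\<in>UNIV. (\<Prod>k\<in>UNIV. g $ (\<pi> \<circ> i) k $ l k) * T $ (l, j)) =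
         (\<Sum>l\<in>UNIV. T $ (\<pi> \<circ> i, l) * (\<Prod>k\<in>UNIV. g $ l k $ j k))"
    by (intro invariant_commute assms)
  have entry: "(\<Prod>k\<in>UNIV. g $ x k $ y k) = (if x = \<pi> \<circ> y then 1 else 0)"
    for x y :: "'r \<Rightarrow> 'n option"
    by (simp add: g_def prod_indicator_eq fun_eq_iff)
  have "\<pi> \<circ> i = \<pi> \<circ> l \<longleftrightarrow> i = l" for l by (auto simp: fun_eq_iff inj)
  then show ?thesis
    using comm unfolding entry
    by (simp add: mult_delta_left mult_delta_right del: o_apply comp_apply)
qed

text \<open>
  Compares coefficients under the transvection \<open>\<eta>\<^sub>a \<mapsto> \<eta>\<^sub>a + \<eta>\<^sub>b\<close>, where
  \<open>\<eta>\<^sub>a = \<eta>\<close> is allowed but \<open>\<eta>\<^sub>b\<close> must lie in \<open>V\<close>. By weight, only the terms with a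
  single replacement survive.
\<close>

lemma invariant_polarize:
  fixes T :: "('n::finite, 'r::finite) mixed_tensor"
  assumes T: "T \<in> tensor_invariants parabolic_group"
    and b: "Some b \<notin> range j" and a: "a \<noteq> Some b" and p: "i p = a"
    and i: "Some b \<notin> range i"
  shows "T $ (i, j) = (\<Sum>q | j q = a. T $ (i(p := Some b), j(q := Some b)))"
proof -
  let ?i = "i(p := Some b)"
  \<comment> \<open>The off-diagonal entry sits in row \<open>Some b\<close>, never in row
    \<open>None\<close>, so \<open>g 1\<close> stabilizes \<open>V\<close>; its inverse is
    \<open>g (-1)\<close>.\<close>
  define g :: "complex \<Rightarrow> complex ^ 'n option ^ 'n option"
    where "g z = (\<chi> x y. if x = y then 1 else if x = Some b \<and> y = a then z else 0)" for z
  have "g 1 ** g (-1) = mat 1"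
  proof -
    have "(\<Sum>l\<in>UNIV. g 1 $ x $ l * g (-1) $ l $ y) = (if x = y then 1 else 0)" for x y
    proof -
      have "(\<Sum>l\<in>UNIV. g 1 $ x $ l * g (-1) $ l $ y) =
          (\<Sum>l\<in>UNIV. (if l = x then g (-1) $ x $ y else 0) +
             (if l = a then if x = Some b then g (-1) $ a $ y else 0 else 0))"
        using a by (intro sum.cong) (auto simp: g_def)
      also have "\<dots> = g (-1) $ x $ y + (if x = Some b then g (-1) $ a $ y else 0)"
        by (simp add: sum.distrib)
      also have "\<dots> = (if x = y then 1 else 0)"
        using a by (auto simp: g_def)
      finally show ?thesis .
    qed
    then show ?thesis by (simp add: vec_eq_iff matrix_matrix_mult_def mat_def)
  qed
  then have "invertible (g 1)" using matrix_left_right_inverse by (auto simp: invertible_def)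
  then have comm: "(\<Sum>l\<in>UNIV. (\<Prod>k\<in>UNIV. g 1 $ ?i k $ l k) * T $ (l, j)) =
         (\<Sum>l\<in>UNIV. T $ (?i, l) * (\<Prod>k\<in>UNIV. g 1 $ l k $ j k))"
    by (intro invariant_commute T) (auto simp: g_def)
  have entry: "(\<Prod>k\<in>UNIV. g 1 $ x k $ y k) =
      (if \<forall>k. x k = y k \<or> x k = Some b \<and> y k = a then 1 else 0)" for x y :: "'r \<Rightarrow> 'n option"
    unfolding prod_indicator_eq [symmetric] by (intro prod.cong) (auto simp: g_def)
  have mult: "card {k. x k = Some b} = card {k. y k = Some b}" if "T $ (x, y) \<noteq> 0" for x y
    using invariant_multiplicities [OF T that] .
  have none: "{k. j k = Some b} = {}" using b by (metis (mono_tags) empty_Collect_eq rangeI)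
  have one: "{k. ?i k = Some b} = {p}" using i by (auto simp: image_iff) metis
  \<comment> \<open>Since \<open>j\<close> misses \<open>Some b\<close>, only those \<open>l\<close>
    that miss it contribute; then \<open>l p\<close> must be \<open>a\<close>, which forces
    \<open>l = i\<close>.\<close>
  have left: "(\<Prod>k\<in>UNIV. g 1 $ ?i k $ l k) * T $ (l, j) = (if l = i then T $ (i, j) else 0)" for l
  proof (cases "l p = Some b")
    case True
    then have "card {k. l k = Some b} \<noteq> 0" by auto
    then have "T $ (l, j) = 0" using mult [of l j] none by force
    moreover have "l \<noteq> i" using True a p by auto
    ultimately show ?thesis by simp
  next
    case False
    have "(\<forall>k. ?i k = l k \<or> ?i k = Some b \<and> l k = a) \<longleftrightarrow> l = i"
    proof
      assume h: "\<forall>k. ?i k = l k \<or> ?i k = Some b \<and> l k = a"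
      show "l = i"
      proof
        fix k
        have "i k \<noteq> Some b" using i by (metis rangeI)
        then show "l k = i k" using h [rule_format, of k] False p by (cases "k = p") auto
      qed
    qed (use p in auto)
    then show ?thesis by (simp add: entry)
  qed
  have inj: "inj_on (\<lambda>q. j(q := Some b)) {q. j q = a}"
  proof
    fix q q' assume "j(q := Some b) = j(q' := Some b)"
    then have "(j(q' := Some b)) q = Some b" by (metis fun_upd_same)
    then show "q = q'" using b by (metis fun_upd_other rangeI)
  qed
  \<comment> \<open>\<open>Some b\<close> occurs once in \<open>?i\<close>, hence once in every
    contributing \<open>l\<close>: exactly one \<open>a\<close> of \<open>j\<close> is
    overwritten.\<close>
  have right: "T $ (?i, l) * (\<Prod>k\<in>UNIV. g 1 $ l k $ j k) = 0"
    if "l \<notin> (\<lambda>q. j(q := Some b)) ` {q. j q = a}" for l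
  proof (rule ccontr)
    assume *: "T $ (?i, l) * (\<Prod>k\<in>UNIV. g 1 $ l k $ j k) \<noteq> 0"
    then have l: "\<forall>k. l k = j k \<or> l k = Some b \<and> j k = a"
      by (auto simp: entry split: if_splits)
    have "card {k. l k = Some b} = 1" using * mult [of ?i l] one by simp
    then obtain q where q: "{k. l k = Some b} = {q}" by (auto simp: card_1_singleton_iff)
    have "l = j(q := Some b)" "j q = a"
      using q l b by (auto simp: fun_eq_iff set_eq_iff) (metis rangeI)+
    then show False using that by auto
  qed
  have "(\<Sum>l\<in>UNIV. T $ (?i, l) * (\<Prod>k\<in>UNIV. g 1 $ l k $ j k)) =
      (\<Sum>l\<in>(\<lambda>q. j(q := Some b)) ` {q. j q = a}. T $ (?i, l) * (\<Prod>k\<in>UNIV. g 1 $ l k $ j k))"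
    using right by (intro sum.mono_neutral_right) auto
  also have "\<dots> = (\<Sum>q | j q = a. T $ (?i, j(q := Some b)))"
    unfolding sum.reindex [OF inj] by (rule sum.cong) (auto simp: entry)
  finally show ?thesis using comm unfolding left by simp
qed

section \<open>Permutations relating multi-indices\<close>

text \<open>Equal multiplicities give \<open>i\<close> and \<open>j\<close> the same values. Sending
  \<open>k\<close> to the position where the injective \<open>j\<close> takes the value
  \<open>i k\<close> is then surjective on a finite set, hence bijective.\<close>

lemma equal_multiplicities_perm_index:
  assumes "inj j" "\<And>a. card {k. i k = a} = card {k. j k = a}"
  obtains \<sigma> where "\<sigma> permutes UNIV" "i = perm_index \<sigma> (j :: 'r::finite \<Rightarrow> 'n option)"
proof -
  have "i k \<in> range j" for k
  proof (rule ccontr)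
    assume "i k \<notin> range j"
    then have "{l. j l = i k} = {}" by (metis (mono_tags) empty_Collect_eq rangeI)
    then have "card {l. i l = i k} = 0" using assms(2) [of "i k"] by simp
    then show False by auto
  qed
  then have j: "j (inv_into UNIV j (i k)) = i k" for k by (simp add: f_inv_into_f)
  have i: "j k \<in> range i" for k
  proof (rule ccontr)
    assume "j k \<notin> range i"
    then have "{l. i l = j k} = {}" by (metis (mono_tags) empty_Collect_eq rangeI)
    then have "card {l. j l = j k} = 0" using assms(2) [of "j k"] by simp
    then show False by auto
  qed
  have "y \<in> range (inv_into UNIV j \<circ> i)" for y
  proof -
    obtain k where "i k = j y" using i [of y] by (metis imageE)
    then have "(inv_into UNIV j \<circ> i) k = y" using assms(1) by simp
    then show ?thesis by blast
  qed
  then have "surj (inv_into UNIV j \<circ> i)" by blast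
  then have bij: "bij (inv_into UNIV j \<circ> i)" by (simp add: bij_def finite_UNIV_surj_inj)
  show ?thesis
  proof
    \<comment> \<open>\<open>perm_index\<close> composes with the inverse of its permutation, so the
      witness is the inverse of the position map.\<close>
    show "inv_into UNIV (inv_into UNIV j \<circ> i) permutes UNIV"
      using bij_imp_bij_inv [OF bij] unfolding permutes_univ bij_iff .
    show "i = perm_index (inv_into UNIV (inv_into UNIV j \<circ> i)) j"
      by (simp add: perm_index_def inv_inv_eq bij j)
  qed
qed

text \<open>The two ranges have equally large complements, and a bijection between these completes
  \<open>g \<circ> inv_into UNIV f\<close>.\<close>

lemma extend_inj_to_bij:
  fixes f g :: "'a \<Rightarrow> 'b::finite"
  assumes "inj f" "inj g"
  obtains \<pi> where "bij \<pi>" "g = \<pi> \<circ> f"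
proof -
  have gf: "bij_betw (g \<circ> inv_into UNIV f) (range f) (range g)"
    using bij_betw_trans [OF bij_betw_inv_into [OF inj_on_imp_bij_betw [OF assms(1)]]
        inj_on_imp_bij_betw [OF assms(2)]] .
  then have "card (- range f) = card (- range g)"
    using bij_betw_same_card [OF gf] by (simp add: Compl_eq_Diff_UNIV card_Diff_subset)
  then obtain h where h: "bij_betw h (- range f) (- range g)"
    using finite_same_card_bij [OF finite finite] by metis
  have "bij_betw (\<lambda>x. if x \<in> range f then (g \<circ> inv_into UNIV f) x else h x)
      (range f \<union> - range f) (range g \<union> - range g)"
    by (rule bij_betw_disjoint_Un [OF gf h]) auto
  then have "bij (\<lambda>x. if x \<in> range f then (g \<circ> inv_into UNIV f) x else h x)" by simp
  then show ?thesis by (rule that) (auto simp: fun_eq_iff assms(1))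
qed

section \<open>Vanishing criterion and spanning\<close>

text \<open>
  If some value of \<open>j\<close> can be overwritten at one position without losing a basis vector of
  \<open>V\<close>, the polarization identity reduces the coefficient at \<open>j\<close> to coefficients at
  multi-indices that use more basis vectors of \<open>V\<close>; otherwise \<open>j\<close> is injective with values
  in the basis of \<open>V\<close>.
\<close>

lemma invariant_zero:
  fixes T :: "('n::finite, 'r::finite) mixed_tensor"
  assumes card: "CARD('r) \<le> CARD('n)" and T: "T \<in> tensor_invariants parabolic_group"
    and f: "inj f" and zero: "\<And>i. T $ (i, Some \<circ> f) = 0"
  shows "T = 0"
proof -
  \<comment> \<open>Relabelling carries the vanishing at \<open>f\<close> to every injective tuple;
    \<open>map_option \<pi>\<close> extends \<open>\<pi>\<close> by fixing
    \<open>None\<close>.\<close>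
  have inj_zero: "T $ (i, Some \<circ> f') = 0" if "inj f'" for i f'
  proof -
    obtain \<pi> where \<pi>: "bij \<pi>" "f' = \<pi> \<circ> f" using extend_inj_to_bij [OF f \<open>inj f'\<close>] .
    have bij: "bij (map_option \<pi>)"
      using \<pi>(1) option.inj_map by (auto simp: bij_def finite_UNIV_inj_surj)
    have "i = map_option \<pi> \<circ> (inv_into UNIV (map_option \<pi>) \<circ> i)"
      using bij by (auto simp: fun_eq_iff bij_is_surj surj_f_inv_f)
    moreover have "Some \<circ> f' = map_option \<pi> \<circ> (Some \<circ> f)" by (auto simp: \<pi>(2))
    ultimately show ?thesis
      using invariant_relabel [OF T bij, of "inv_into UNIV (map_option \<pi>) \<circ> i" "Some \<circ> f"] zero
      by simp
  qed
  have "T $ (i, j) = 0" for i j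
  \<comment> \<open>The measure counts the basis vectors of \<open>V\<close> missing from
    \<open>j\<close>.\<close>
  proof (induction "CARD('n) - card {x. Some x \<in> range j}" arbitrary: i j rule: less_induct)
    case less
    show ?case
    proof (rule ccontr)
      assume nz: "T $ (i, j) \<noteq> 0"
      note mult = invariant_multiplicities [OF T nz]
      have same_range: "x \<in> range i \<longleftrightarrow> x \<in> range j" for x
      proof -
        have "x \<in> range h \<longleftrightarrow> card {k. h k = x} \<noteq> 0" for h :: "'r \<Rightarrow> 'n option" by auto
        from this [of i] this [of j] show ?thesis using mult [of x] by simp
      qed
      \<comment> \<open>For \<open>a\<close> take \<open>None\<close> if it occurs, as overwriting
        it loses nothing in \<open>V\<close>. Otherwise \<open>inj_zero\<close> shows that
        \<open>j\<close> is not injective, and \<open>a\<close> is a repeated value.\<close>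
      have "\<exists>a q0. j q0 = a \<and> (\<forall>q. j q = a \<longrightarrow> (\<forall>x. Some x \<in> range j \<longrightarrow> Some x \<in> j ` (- {q})))"
      proof (cases "None \<in> range j")
        case True
        then obtain q0 where "j q0 = None" by (metis imageE)
        moreover have "Some x \<in> j ` (- {q})" if "j q = None" "Some x \<in> range j" for q x
          using that by force
        ultimately show ?thesis by blast
      next
        case False
        then have "j = Some \<circ> (the \<circ> j)"
          by (auto simp: fun_eq_iff) (metis option.exhaust_sel rangeI)
        then have "\<not> inj j" using inj_zero [of "the \<circ> j" i] nz by (metis inj_on_imageI2)
        then obtain q1 q2 where q: "q1 \<noteq> q2" "j q1 = j q2" by (auto simp: inj_def)
        have "Some x \<in> j ` (- {q})" if jq: "j q = j q1" and x: "Some x \<in> range j" for q x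
        proof -
          obtain k where k: "j k = Some x" using x by auto
          show ?thesis
          proof (cases "k = q")
            case True
            then have "Some x = j (if q = q1 then q2 else q1)" using k q jq by simp
            moreover have "(if q = q1 then q2 else q1) \<in> - {q}" using q by auto
            ultimately show ?thesis by (rule image_eqI)
          qed (use k in force)
        qed
        then show ?thesis by blast
      qed
      then obtain a q0 where a: "j q0 = a"
        and keep: "\<And>q x. j q = a \<Longrightarrow> Some x \<in> range j \<Longrightarrow> Some x \<in> j ` (- {q})" by blast
      let ?R = "\<lambda>j. {x. Some x \<in> range j}"
      \<comment> \<open>Position \<open>q0\<close> is dispensable, so \<open>j\<close> uses at most
        \<open>r - 1 < n\<close> basis vectors of \<open>V\<close>; this leaves a fresh
        \<open>b\<close>.\<close>
      have "card (?R j) < CARD('n)"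
      proof -
        have "Some ` ?R j \<subseteq> j ` (- {q0})" using keep [OF a] by blast
        then have "card (Some ` ?R j) \<le> card (- {q0})"
          by (meson card_image_le card_mono finite finite_imageI order_trans)
        also have "\<dots> < CARD('r)" by (intro psubset_card_mono) auto
        finally show ?thesis using card by (simp add: card_image)
      qed
      then obtain b where b: "Some b \<notin> range j"
        by (metis (mono_tags) UNIV_eq_I less_irrefl mem_Collect_eq)
      have "a \<in> range i" using same_range a by auto
      then obtain p where p: "i p = a" by auto
      \<comment> \<open>Every summand of the polarization identity keeps the old basis vectors and
        gains \<open>b\<close>, so the measure drops.\<close>
      have "T $ (i(p := Some b), j(q := Some b)) = 0" if "j q = a" for q
      proof (rule less)
        have "insert b (?R j) \<subseteq> ?R (j(q := Some b))"
          using keep [OF that] by (auto simp: image_iff)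
        then have "card (insert b (?R j)) \<le> card (?R (j(q := Some b)))" by (intro card_mono) auto
        then show "CARD('n) - card (?R (j(q := Some b))) < CARD('n) - card (?R j)"
          using b \<open>card (?R j) < CARD('n)\<close> by (simp add: card_insert_if)
      qed
      moreover have "a \<noteq> Some b" using a b by (metis rangeI)
      moreover have "Some b \<notin> range i" using b same_range by simp
      ultimately show False using invariant_polarize [where i = i and p = p, OF T b _ p] nz by simp
    qed
  qed
  then show ?thesis by (simp add: vec_eq_iff)
qed

theorem proposition3p2:
  assumes "CARD('r::finite) \<le> CARD('n::finite)"
  shows "(tensor_invariants parabolic_group :: ('n, 'r) mixed_tensor set) =
         vec.span (C_tensor ` {\<sigma>. \<sigma> permutes UNIV})"
proof
  let ?C = "C_tensor ` {\<sigma>. \<sigma> permutes UNIV} :: ('n, 'r) mixed_tensor set"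
  have C: "?C \<subseteq> tensor_invariants parabolic_group"
    using C_tensor_invariant permutes_bij by blast
  then show "vec.span ?C \<subseteq> tensor_invariants parabolic_group"
    by (rule vec.span_minimal) (rule subspace_tensor_invariants)
  show "tensor_invariants parabolic_group \<subseteq> vec.span ?C"
  proof
    fix T :: "('n, 'r) mixed_tensor"
    assume T: "T \<in> tensor_invariants parabolic_group"
    obtain f :: "'r \<Rightarrow> 'n" where f: "inj f"
      using assms card_le_inj [of "UNIV :: 'r set" "UNIV :: 'n set"] by auto
    let ?j = "Some \<circ> f"
    have j: "inj ?j" using f by (simp add: inj_compose)
    \<comment> \<open>Column \<open>?j\<close> of \<open>C_tensor \<sigma>\<close> has its only
      nonzero entry, a 1, in row \<open>perm_index \<sigma> ?j\<close>; the coefficients are read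
      off from \<open>T\<close> there.\<close>
    define U :: "('n, 'r) mixed_tensor"
      where "U = (\<Sum>\<sigma> | \<sigma> permutes UNIV. T $ (perm_index \<sigma> ?j, ?j) *s C_tensor \<sigma>)"
    have U: "U \<in> vec.span ?C"
      unfolding U_def by (intro vec.span_sum vec.span_scale vec.span_base) auto
    have D: "T - U \<in> tensor_invariants parabolic_group"
      using T U \<open>vec.span ?C \<subseteq> _\<close> by (intro vec.subspace_diff [OF subspace_tensor_invariants]) auto
    \<comment> \<open>These rows are distinct for distinct permutations, so each entry of
      \<open>U\<close> in column \<open>?j\<close> receives at most one summand.\<close>
    have perm_index_inj: "perm_index \<sigma> ?j = perm_index \<tau> ?j \<longleftrightarrow> \<sigma> = \<tau>"
      if "\<sigma> permutes UNIV" "\<tau> permutes UNIV" for \<sigma> \<tau>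
    proof
      assume "perm_index \<sigma> ?j = perm_index \<tau> ?j"
      then have "inv_into UNIV \<sigma> = inv_into UNIV \<tau>"
        using f by (auto simp: perm_index_def fun_eq_iff inj_eq)
      then show "\<sigma> = \<tau>" by (metis that permutes_inv_inv)
    qed simp
    have "(T - U) $ (i, ?j) = 0" for i
    proof (rule ccontr)
      assume "(T - U) $ (i, ?j) \<noteq> 0"
      \<comment> \<open>By weight, a nonzero entry of the invariant \<open>T - U\<close> in column
        \<open>?j\<close> lies in a permuted row, where \<open>U\<close> matches \<open>T\<close> by
        construction.\<close>
      then obtain \<sigma> where \<sigma>: "\<sigma> permutes UNIV" "i = perm_index \<sigma> ?j"
        using equal_multiplicities_perm_index [OF j] invariant_multiplicities [OF D] by metis
      have "U $ (i, ?j) = (\<Sum>\<tau> | \<tau> permutes UNIV. if \<tau> = \<sigma> then T $ (i, ?j) else 0)"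
        unfolding U_def sum_component
        by (rule sum.cong) (auto simp: C_tensor_nth \<sigma> perm_index_inj)
      also have "\<dots> = T $ (i, ?j)" using \<sigma>(1) by simp
      finally show False using \<open>(T - U) $ (i, ?j) \<noteq> 0\<close> by simp
    qed
    then have "T - U = 0" using invariant_zero [OF assms D f] by blast
    then show "T \<in> vec.span ?C" using U by simp
  qed
qed

end
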